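(* Let $r,s$ be co-prime integers with $s\ge 1$ and $r\neq 0$. Then $H$ contains a line $L_\omega$ (for some $\omega\in\mathbb{R}$) if and only if $\widetilde\Omega_1$ contains either a (non-degenerate) interval or the whole $T$-orbit $\{T^k\alpha:k\ge 0\}$ of some point $\alpha\in\frac{1}{ns}\mathbb{Z}\cap[0,1)$.
   Context: Let $n\ge 2$ be an integer and $\mathcal{D}\subset\{0,1,\dots,n-1\}^2$ with $1<\#\mathcal{D}<n^2$. The fractal square $F\subset\mathbb{R}^2$ is the unique non-empty compact set with $F=(F+\mathcal{D})/n$. Let $I=[0,1]^2$, $F_1=(I+\mathcal{D})/n$, $H=F+\mathbb{Z}^2$ and $H_1=F_1+\mathbb{Z}^2$. With $\tau=r/s$, for $\omega\in\mathbb{R}$ let $L_\omega=\{(x,y)\in\mathbb{R}^2: x-\tau y=\omega\}$ (the fibre over $\omega$ of the projection $\pi(x,y)=x-\tau y$). Put $\Omega_1=\{\omega\in\mathbb{R}:L_\omega\subset H_1\}$ and $\widetilde\Omega_1=\Omega_1\cap[0,1)$. The map $T:[0,1)\to[0,1)$ is $Tx=nx\pmod 1$. Horizontal and vertical lines are excluded from consideration. *)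

theory Defs
  imports "HOL-Analysis.Analysis" "HOL-Library.Set_Algebras"
begin

text \<open>The map \<open>A \<mapsto> (A + D) / n\<close>, with \<open>+\<close> the Minkowski sum of sets.\<close>

definition digit_map :: "nat \<Rightarrow> (nat \<times> nat) set \<Rightarrow> (real \<times> real) set \<Rightarrow> (real \<times> real) set"
  where "digit_map n D A = (\<lambda>p. p /\<^sub>R real n) ` (A + map_prod real real ` D)"

definition fractal_square :: "nat \<Rightarrow> (nat \<times> nat) set \<Rightarrow> (real \<times> real) set"
  where "fractal_square n D = (THE F. compact F \<and> F \<noteq> {} \<and> F = digit_map n D F)"

definition first_approx :: "nat \<Rightarrow> (nat \<times> nat) set \<Rightarrow> (real \<times> real) set"
  where "first_approx n D = digit_map n D ({0..1} \<times> {0..1})"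

definition periodic_extension :: "(real \<times> real) set \<Rightarrow> (real \<times> real) set"
  where "periodic_extension A = A + (\<int> \<times> \<int>)"

definition fibre_line :: "real \<Rightarrow> real \<Rightarrow> (real \<times> real) set"
  where "fibre_line \<tau> \<omega> = {(x, y). x - \<tau> * y = \<omega>}"

definition Omega1 :: "nat \<Rightarrow> (nat \<times> nat) set \<Rightarrow> real \<Rightarrow> real set"
  where "Omega1 n D \<tau> = {\<omega>. fibre_line \<tau> \<omega> \<subseteq> periodic_extension (first_approx n D)}"

definition Omega1_tilde :: "nat \<Rightarrow> (nat \<times> nat) set \<Rightarrow> real \<Rightarrow> real set"
  where "Omega1_tilde n D \<tau> = Omega1 n D \<tau> \<inter> {0..<1}"

text \<open>A map of \<open>[0, 1)\<close> into itself; the values outside \<open>[0, 1)\<close> are irrelevant.\<close>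

definition times_map :: "nat \<Rightarrow> real \<Rightarrow> real"
  where "times_map n x = frac (real n * x)"

text \<open>The definite description in \<^const>\<open>fractal_square\<close> is justified by existence and uniqueness:\<close>

lemma mem_digit_map:
  "q \<in> digit_map n D A \<longleftrightarrow> (\<exists>p\<in>A. \<exists>d\<in>D. q = (p + map_prod real real d) /\<^sub>R real n)"
  unfolding digit_map_def set_plus_def image_iff bex_simps mem_Collect_eq by blast

lemma digit_map_mono: "A \<subseteq> B \<Longrightarrow> digit_map n D A \<subseteq> digit_map n D B"
  by (auto simp: mem_digit_map subset_iff)

lemma compact_digit_map:
  assumes "finite D" "compact A"
  shows "compact (digit_map n D A)"
proof -
  have "digit_map n D A = (\<Union>d\<in>D. (\<lambda>p. (p + map_prod real real d) /\<^sub>R real n) ` A)"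
    unfolding set_eq_iff mem_digit_map UN_iff image_iff by blast
  moreover have "compact ((\<lambda>p. (p + map_prod real real d) /\<^sub>R real n) ` A)" for d
    by (intro compact_continuous_image continuous_intros assms)
  ultimately show ?thesis
    using assms(1) by (simp add: compact_UN)
qed

lemma digit_map_fixed_subset:
  assumes n: "n \<ge> 2"
    and A: "compact A" "A = digit_map n D A"
    and B: "compact B" "B \<noteq> {}" "B = digit_map n D B"
  shows "A \<subseteq> B"
proof (cases "A = {}")
  case False
  have "continuous_on A (\<lambda>x. infdist x B)"
    by (intro continuous_intros)
  then obtain a where a: "a \<in> A" and max: "\<And>x. x \<in> A \<Longrightarrow> infdist x B \<le> infdist a B"
    using continuous_attains_sup[OF A(1) False] by blast
  from a A(2) obtain p d where pd: "p \<in> A" "d \<in> D"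
    and eq: "a = (p + map_prod real real d) /\<^sub>R real n"
    by (metis mem_digit_map)
  obtain b where b: "b \<in> B" "infdist p B = dist p b"
    using infdist_attains_inf[OF compact_imp_closed[OF B(1)] B(2)] by metis
  let ?b = "(b + map_prod real real d) /\<^sub>R real n"
  have "?b \<in> B"
    using B(3) b(1) pd(2) by (metis mem_digit_map)
  then have "infdist a B \<le> dist a ?b"
    by (rule infdist_le)
  also have "\<dots> = dist p b / real n"
    unfolding eq dist_norm
    by (simp add: divide_inverse mult.commute flip: scaleR_right_diff_distrib)
  also have "\<dots> \<le> infdist a B / real n"
    using max[OF pd(1)] b(2) by (simp add: divide_right_mono)
  finally have "infdist a B * (real n - 1) \<le> 0"
    using n by (simp add: field_simps)
  then have "infdist a B \<le> 0"
    using n by (simp add: mult_le_0_iff)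
  then have "infdist x B = 0" if "x \<in> A" for x
    using max[OF that] infdist_nonneg[of x B] by linarith
  then show ?thesis
    using in_closed_iff_infdist_zero[OF compact_imp_closed[OF B(1)] B(2)] by blast
qed simp

lemma digit_map_unit_square:
  assumes "n \<ge> 1" "D \<subseteq> {..<n} \<times> {..<n}"
  shows "digit_map n D ({0..1} \<times> {0..1}) \<subseteq> {0..1} \<times> {0..1}"
proof
  fix q assume "q \<in> digit_map n D ({0..1} \<times> {0..1})"
  then obtain x y i j where *: "x \<in> {0..1}" "y \<in> {0..1}" "(i, j) \<in> D"
      "q = ((x + real i) / real n, (y + real j) / real n)"
    by (auto simp: mem_digit_map divide_inverse mult.commute)
  then have "i < n" "j < n"
    using assms(2) by auto
  then have "real i + 1 \<le> real n" "real j + 1 \<le> real n"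
    by simp_all
  with * assms(1) show "q \<in> {0..1} \<times> {0..1}"
    by (auto simp: divide_le_eq)
qed

theorem fractal_square_ex1:
  assumes n: "n \<ge> 2" and D: "D \<subseteq> {..<n} \<times> {..<n}" "D \<noteq> {}"
  shows "\<exists>!F. compact F \<and> F \<noteq> {} \<and> F = digit_map n D F"
proof (rule ex_ex1I)
  have fin: "finite D"
    using D(1) by (rule finite_subset) simp
  define K where "K k = (digit_map n D ^^ k) ({0..1} \<times> {0..1})" for k
  have K_Suc: "K (Suc k) = digit_map n D (K k)" for k
    by (simp add: K_def)
  have K_comp: "compact (K k)" for k
  proof (induction k)
    case 0
    show ?case by (simp add: K_def compact_Times)
  qed (simp add: K_Suc compact_digit_map fin)
  have K_ne: "K k \<noteq> {}" for k
  proof (induction k)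
    case 0
    show ?case by (simp add: K_def)
  next
    case (Suc k)
    then obtain p d where "p \<in> K k" "d \<in> D"
      using D(2) by blast
    then have "(p + map_prod real real d) /\<^sub>R real n \<in> K (Suc k)"
      unfolding K_Suc mem_digit_map by blast
    then show ?case by blast
  qed
  have K_step: "K (Suc k) \<subseteq> K k" for k
  proof (induction k)
    case 0
    show ?case using digit_map_unit_square[of n D] n D(1) by (simp add: K_def)
  next
    case (Suc k)
    then show ?case by (simp only: K_Suc digit_map_mono)
  qed
  have K_anti: "K l \<subseteq> K k" if "k \<le> l" for k l
    using lift_Suc_antimono_le[of K, OF K_step that] .
  define F where "F = (\<Inter>k. K k)"
  have "compact F"
    unfolding F_def by (rule compact_Inter) (auto simp: K_comp)
  moreover have "F \<noteq> {}"
    unfolding F_def using K_comp K_ne K_anti by (rule compact_nest)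
  moreover have "digit_map n D F \<subseteq> F"
  proof -
    have "digit_map n D F \<subseteq> K (Suc k)" for k
      unfolding K_Suc F_def by (intro digit_map_mono) blast
    then show ?thesis
      unfolding F_def using K_step by blast
  qed
  moreover have "F \<subseteq> digit_map n D F"
  proof
    fix q assume q: "q \<in> F"
    have "\<exists>d. d \<in> D \<and> (\<exists>p\<in>K k. q = (p + map_prod real real d) /\<^sub>R real n)" for k
    proof -
      have "q \<in> K (Suc k)" using q by (auto simp: F_def)
      then show ?thesis unfolding K_Suc mem_digit_map by blast
    qed
    then obtain e where e: "\<And>k. e k \<in> D"
        "\<And>k. \<exists>p\<in>K k. q = (p + map_prod real real (e k)) /\<^sub>R real n"
      by metis
    have "finite (range e)"
      using e(1) fin by (meson finite_subset image_subsetI)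
    then obtain k0 where inf: "infinite {k. e k = e k0}"
      using pigeonhole_infinite[of UNIV e] by auto
    define p where "p = real n *\<^sub>R q - map_prod real real (e k0)"
    have q_eq: "q = (p + map_prod real real (e k0)) /\<^sub>R real n"
      using n by (simp add: p_def)
    have "p \<in> K k" for k
    proof -
      obtain l where l: "k \<le> l" "e l = e k0"
        using inf unfolding infinite_nat_iff_unbounded_le by auto
      obtain p' where p': "p' \<in> K l" "q = (p' + map_prod real real (e k0)) /\<^sub>R real n"
        using e(2)[of l] l(2) by auto
      have "p' = p"
        using n p'(2) by (simp add: p_def)
      then show ?thesis
        using p'(1) K_anti[OF l(1)] by blast
    qed
    then have "p \<in> F" by (simp add: F_def)
    with q_eq e(1) show "q \<in> digit_map n D F"
      unfolding mem_digit_map by blast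
  qed
  ultimately show "\<exists>F. compact F \<and> F \<noteq> {} \<and> F = digit_map n D F"
    by blast
next
  fix A B
  assume "compact A \<and> A \<noteq> {} \<and> A = digit_map n D A"
    and "compact B \<and> B \<noteq> {} \<and> B = digit_map n D B"
  then show "A = B"
    using digit_map_fixed_subset[OF n] by (meson subset_antisym)
qed

end

theory Submission
  imports Defs
begin

text \<open>
  Write \<open>H\<close>, \<open>H\<^sub>1\<close> for the periodic extensions of the fractal square \<open>F\<close> and of its first
  approximation. Up to the grid lines, \<open>H\<close> is the set of points whose dilates by all \<open>n\<^sup>k\<close> lie in
  \<open>H\<^sub>1\<close>. A line that is neither horizontal nor vertical meets the grid lines in a countable set and
  \<open>H\<close> is closed, so \<open>L\<^sub>\<omega> \<subseteq> H\<close> iff \<open>n\<^sup>k \<omega> \<in> \<Omega>\<^sub>1\<close> for all \<open>k\<close>.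
  Similarly, \<open>\<omega> \<notin> \<Omega>\<^sub>1\<close> iff the line over \<open>n \<omega>\<close> meets the interior of a missing unit cell; the
  projections of these interiors are open intervals with end points in \<open>\<int> / s\<close>. Hence a point of
  \<open>\<Omega>\<^sub>1\<close> outside \<open>\<int> / (n s)\<close> brings along the whole interval \<open>[m / (n s), (m + 1) / (n s)]\<close> around it.
  As \<open>\<Omega>\<^sub>1\<close> is \<open>1 / s\<close>-periodic, a suitable translate of that interval contains the point
  \<open>c / ((n - 1) s)\<close> with \<open>c = m mod n\<close>, which multiplication by \<open>n\<close> fixes modulo \<open>1 / s\<close>.
\<close>

section \<open>Comparison of sets that are invariant under the digit map\<close>

text \<open>Each branch of the digit map contracts by the factor 1 / \<open>n\<close>, so the
  largest distance from a point of \<open>A\<close> to \<open>B\<close> is at most 1 /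
  \<open>n\<close> times itself, hence zero. One-sided inclusions suffice for this; they allow
  \<open>B\<close> to be the unit square, and \<open>A\<close> to be a set not known to be a fixed
  point.\<close>

lemma subset_of_digit_map_invariant:
  assumes n: "n \<ge> 2"
    and A: "compact A" "A \<subseteq> digit_map n D A"
    and B: "closed B" "B \<noteq> {}" "digit_map n D B \<subseteq> B"
  shows "A \<subseteq> B"
proof (cases "A = {}")
  case False
  have "continuous_on A (\<lambda>x. infdist x B)"
    by (intro continuous_intros)
  then obtain a where a: "a \<in> A" and max: "\<And>x. x \<in> A \<Longrightarrow> infdist x B \<le> infdist a B"
    using continuous_attains_sup[OF A(1) False] by blast
  from a A(2) obtain p d where pd: "p \<in> A" "d \<in> D"
    and eq: "a = (p + map_prod real real d) /\<^sub>R real n"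
    by (meson mem_digit_map subsetD)
  obtain b where b: "b \<in> B" "infdist p B = dist p b"
    using infdist_attains_inf[OF B(1,2)] by metis
  let ?b = "(b + map_prod real real d) /\<^sub>R real n"
  have "?b \<in> B"
    using B(3) b(1) pd(2) by (meson mem_digit_map subsetD)
  then have "infdist a B \<le> dist a ?b"
    by (rule infdist_le)
  also have "\<dots> = infdist p B / real n"
    unfolding eq b(2) dist_norm
    by (simp add: divide_inverse mult.commute flip: scaleR_right_diff_distrib)
  also have "\<dots> \<le> infdist a B / real n"
    using max[OF pd(1)] by (simp add: divide_right_mono)
  finally have "infdist a B * (real n - 1) \<le> 0"
    using n by (simp add: field_simps)
  then have "infdist a B \<le> 0"
    using n by (simp add: mult_le_0_iff)
  then have "infdist x B = 0" if "x \<in> A" for x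
    using max[OF that] infdist_nonneg[of x B] by linarith
  then show ?thesis
    using in_closed_iff_infdist_zero[OF B(1,2)] by blast
qed simp

section \<open>Integer translates\<close>

lemma mem_periodic_extension:
  "p \<in> periodic_extension A \<longleftrightarrow> (\<exists>a b::int. p - (of_int a, of_int b) \<in> A)"
proof
  assume "p \<in> periodic_extension A"
  then obtain q z where "q \<in> A" "z \<in> \<int> \<times> \<int>" "p = q + z"
    unfolding periodic_extension_def by (blast elim: set_plus_elim)
  then show "\<exists>a b::int. p - (of_int a, of_int b) \<in> A"
    by (metis SigmaE Ints_cases add_diff_cancel_right')
next
  assume "\<exists>a b::int. p - (of_int a, of_int b) \<in> A"
  then obtain a b :: int where "p - (of_int a, of_int b) \<in> A" by blast
  then have "p - (of_int a, of_int b) + (of_int a, of_int b) \<in> periodic_extension A"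
    unfolding periodic_extension_def by (intro set_plus_intro) auto
  then show "p \<in> periodic_extension A" by simp
qed

lemma periodic_extension_mono: "A \<subseteq> B \<Longrightarrow> periodic_extension A \<subseteq> periodic_extension B"
  unfolding subset_iff mem_periodic_extension by blast

lemma periodic_extension_shift:
  fixes a b :: int
  assumes "p \<in> periodic_extension A"
  shows "p + (of_int a, of_int b) \<in> periodic_extension A"
proof -
  from assms obtain c d :: int where "p - (of_int c, of_int d) \<in> A"
    by (auto simp: mem_periodic_extension)
  then have "p + (of_int a, of_int b) - (of_int (a + c), of_int (b + d)) \<in> A"
    by (cases p) simp
  then show ?thesis
    unfolding mem_periodic_extension by blast
qed

lemma closed_periodic_extension:
  assumes "compact A"
  shows "closed (periodic_extension A)"
proof -
  have "periodic_extension A = (\<Union>x\<in>A. \<Union>y\<in>\<int> \<times> \<int>. {x + y})"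
    unfolding periodic_extension_def by (auto simp: set_plus_def)
  then show ?thesis
    using compact_closed_sums[OF assms closed_Times[OF closed_Ints closed_Ints]]
    by (simp only:)
qed

section \<open>Base-\<open>n\<close> digits away from the grid lines\<close>

text \<open>At such points no dilate lies on the boundary of a unit cell, so the
  base-\<open>n\<close> digits of both coordinates are unambiguous at every level.\<close>

definition off_grid :: "nat \<Rightarrow> real \<times> real \<Rightarrow> bool"
  where "off_grid n p \<longleftrightarrow> (\<forall>k. real n ^ k * fst p \<notin> \<int> \<and> real n ^ k * snd p \<notin> \<int>)"

lemma off_grid_scale: "off_grid n p \<Longrightarrow> off_grid n (real n *\<^sub>R p)"
  unfolding off_grid_def
  by (metis fst_scaleR snd_scaleR power_Suc2 mult.assoc real_scaleR_def)

lemma off_grid_1: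
  assumes "off_grid n (x, y)"
  shows "real n * x \<notin> \<int>" "real n * y \<notin> \<int>"
  using assms[unfolded off_grid_def, rule_format, of 1] by simp_all

text \<open>Tells whether the unit cell with lower left corner (\<open>i\<close>, \<open>j\<close>)
  belongs to the \<open>n\<close>-fold dilate of H_1. That dilate has period \<open>n\<close> in
  both directions, hence the reduction modulo \<open>n\<close>.\<close>

definition digit_cell :: "nat \<Rightarrow> (nat \<times> nat) set \<Rightarrow> int \<Rightarrow> int \<Rightarrow> bool"
  where "digit_cell n D i j \<longleftrightarrow> (nat (i mod int n), nat (j mod int n)) \<in> D"

text \<open>Only \<open>u = 1\<close> could push the floor into the next cell, and it would make
  \<open>real n * x\<close> an integer.\<close>

lemma floor_mod_eq_digit:
  fixes x u :: real and a :: int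
  assumes "n \<ge> 1" "i < n" "0 \<le> u" "u \<le> 1" "real n * x \<notin> \<int>"
    and x: "x - of_int a = (u + real i) / real n"
  shows "nat (\<lfloor>real n * x\<rfloor> mod int n) = i"
proof -
  have eq: "real n * x = u + of_int (int i + int n * a)"
    using x assms(1) by (simp add: field_simps)
  with assms(5) have "u \<noteq> 1"
    by (metis Ints_of_int of_int_1 of_int_add)
  with eq assms(3,4) have "\<lfloor>real n * x\<rfloor> = int i + int n * a"
    by linarith
  with assms(2) show ?thesis by simp
qed

text \<open>One step of the base-\<open>n\<close> expansion: the floor of \<open>real n * x\<close>
  is \<open>n\<close> times the floor of \<open>x\<close> plus a digit, also for negative
  \<open>x\<close>.\<close>

lemma digit_expansion:
  fixes x :: real
  assumes "n \<ge> 1"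
  shows "frac x = (frac (real n * x) + real (nat (\<lfloor>real n * x\<rfloor> mod int n))) / real n"
proof -
  have "\<lfloor>real n * x\<rfloor> div int n = \<lfloor>x\<rfloor>"
    using assms floor_divide_real_eq_div[of "int n" "real n * x"] by simp
  then have "\<lfloor>real n * x\<rfloor> = int n * \<lfloor>x\<rfloor> + \<lfloor>real n * x\<rfloor> mod int n"
    by (metis mult_div_mod_eq)
  then have "of_int \<lfloor>real n * x\<rfloor> = real n * of_int \<lfloor>x\<rfloor> + of_int (\<lfloor>real n * x\<rfloor> mod int n)"
    by (metis of_int_add of_int_mult of_int_of_nat_eq)
  moreover have "real (nat (\<lfloor>real n * x\<rfloor> mod int n)) = of_int (\<lfloor>real n * x\<rfloor> mod int n)"
    using assms by simp
  ultimately have "real n * x = frac (real n * x) + real n * of_int \<lfloor>x\<rfloor> + real (nat (\<lfloor>real n * x\<rfloor> mod int n))"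
    by (simp add: frac_def)
  then show ?thesis
    using assms by (simp add: frac_def field_simps)
qed

lemma frac_mem_digit_map:
  assumes "n \<ge> 1" "digit_cell n D \<lfloor>real n * x\<rfloor> \<lfloor>real n * y\<rfloor>"
    and "(frac (real n * x), frac (real n * y)) \<in> A"
  shows "(frac x, frac y) \<in> digit_map n D A"
  unfolding mem_digit_map
proof (intro bexI)
  let ?d = "(nat (\<lfloor>real n * x\<rfloor> mod int n), nat (\<lfloor>real n * y\<rfloor> mod int n))"
  show "?d \<in> D" using assms(2) by (simp add: digit_cell_def)
  show "(frac x, frac y) =
      ((frac (real n * x), frac (real n * y)) + map_prod real real ?d) /\<^sub>R real n"
    using digit_expansion[OF assms(1), of x] digit_expansion[OF assms(1), of y]
    by (simp add: divide_inverse mult.commute del: of_nat_nat)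
qed (fact assms(3))

lemma mem_periodic_extension_frac:
  "(frac x, frac y) \<in> A \<Longrightarrow> (x, y) \<in> periodic_extension A"
  unfolding mem_periodic_extension frac_def by (metis diff_Pair)

section \<open>The fractal square, its first approximation and their periodic extensions\<close>

context
  fixes n :: nat and D :: "(nat \<times> nat) set"
  assumes n2: "n \<ge> 2" and D_sub: "D \<subseteq> {..<n} \<times> {..<n}" and D_ne: "D \<noteq> {}"
begin

lemma fractal_square: "compact (fractal_square n D)" "fractal_square n D \<noteq> {}"
    "fractal_square n D = digit_map n D (fractal_square n D)"
  using theI'[OF fractal_square_ex1[OF n2 D_sub D_ne]]
  unfolding fractal_square_def by blast+

lemma finite_digits: "finite D"
  using D_sub by (rule finite_subset) simp

lemma F_subset_first_approx: "fractal_square n D \<subseteq> first_approx n D"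
proof -
  have "fractal_square n D \<subseteq> {0..1} \<times> {0..1}"
    by (rule subset_of_digit_map_invariant[where n = n and D = D])
       (use n2 D_sub fractal_square digit_map_unit_square[of n D] in \<open>simp_all add: closed_Times\<close>)
  then show ?thesis
    using fractal_square(3) digit_map_mono unfolding first_approx_def by metis
qed

lemma closed_H\<^sub>1: "closed (periodic_extension (first_approx n D))"
  unfolding first_approx_def
  by (intro closed_periodic_extension compact_digit_map finite_digits compact_Times) auto

lemma closed_H: "closed (periodic_extension (fractal_square n D))"
  by (intro closed_periodic_extension fractal_square)

text \<open>Dilating F by \<open>n\<close> gives F + \<open>D\<close>, and the digits are absorbed
  into the integer translation.\<close>

lemma scale_H:
  assumes "p \<in> periodic_extension (fractal_square n D)"
  shows "real n *\<^sub>R p \<in> periodic_extension (fractal_square n D)"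
proof -
  from assms obtain a b :: int where "p - (of_int a, of_int b) \<in> fractal_square n D"
    by (auto simp: mem_periodic_extension)
  then obtain q d where q: "q \<in> fractal_square n D" "p - (of_int a, of_int b) = (q + map_prod real real d) /\<^sub>R real n"
    using fractal_square(3) mem_digit_map by metis
  then have "real n *\<^sub>R (p - (of_int a, of_int b)) = q + map_prod real real d"
    using n2 by simp
  then have "real n *\<^sub>R p - (of_int (int n * a + int (fst d)), of_int (int n * b + int (snd d))) = q"
    by (cases p; cases q; cases d) (simp add: algebra_simps)
  then show ?thesis
    using q(1) unfolding mem_periodic_extension by blast
qed

lemma mem_H\<^sub>1_iff_digit_cell:
  assumes "real n * x \<notin> \<int>" "real n * y \<notin> \<int>"
  shows "(x, y) \<in> periodic_extension (first_approx n D) \<longleftrightarrow> digit_cell n D \<lfloor>real n * x\<rfloor> \<lfloor>real n * y\<rfloor>"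
proof
  assume "(x, y) \<in> periodic_extension (first_approx n D)"
  then obtain a b :: int and u v i j where *: "0 \<le> u" "u \<le> 1" "0 \<le> v" "v \<le> 1" "(i, j) \<in> D"
      "x - of_int a = (u + real i) / real n" "y - of_int b = (v + real j) / real n"
    by (auto simp: mem_periodic_extension first_approx_def mem_digit_map divide_inverse mult.commute)
  moreover from *(5) D_sub have "i < n" "j < n" by auto
  ultimately show "digit_cell n D \<lfloor>real n * x\<rfloor> \<lfloor>real n * y\<rfloor>"
    using floor_mod_eq_digit[of n i u x a] floor_mod_eq_digit[of n j v y b] n2 assms
    by (simp add: digit_cell_def)
next
  assume "digit_cell n D \<lfloor>real n * x\<rfloor> \<lfloor>real n * y\<rfloor>"
  moreover have "(frac (real n * x), frac (real n * y)) \<in> {0..1} \<times> {0..1}"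
    by (simp add: frac_lt_1 less_imp_le)
  ultimately show "(x, y) \<in> periodic_extension (first_approx n D)"
    using frac_mem_digit_map[of n] n2 unfolding first_approx_def
    by (intro mem_periodic_extension_frac) simp
qed

text \<open>The fractional parts of all points satisfying the hypotheses form a bounded set
  \<open>G\<close>. Reading off the first digit gives \<open>G \<subseteq> digit_map n D G\<close>.
  The closure inherits this inclusion, since the digit map sends compact sets to closed ones, and
  therefore lies in F by comparison.\<close>

lemma off_grid_mem_H:
  assumes "off_grid n (x, y)" "\<And>k. (real n ^ k * x, real n ^ k * y) \<in> periodic_extension (first_approx n D)"
  shows "(x, y) \<in> periodic_extension (fractal_square n D)"
proof -
  define G where "G = {(frac x, frac y) |x y. off_grid n (x, y) \<and>
    (\<forall>k. (real n ^ k * x, real n ^ k * y) \<in> periodic_extension (first_approx n D))}"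
  have "G \<subseteq> {0..1} \<times> {0..1}"
    unfolding G_def by (auto simp: frac_lt_1 less_imp_le)
  then have "bounded G"
    by (rule bounded_subset[rotated]) (intro bounded_Times, auto)
  have sub: "G \<subseteq> digit_map n D G"
  proof
    fix q assume "q \<in> G"
    then obtain x y where q: "q = (frac x, frac y)" and og: "off_grid n (x, y)"
      and mem: "\<And>k. (real n ^ k * x, real n ^ k * y) \<in> periodic_extension (first_approx n D)"
      unfolding G_def by blast
    have "(real n ^ k * (real n * x), real n ^ k * (real n * y)) \<in> periodic_extension (first_approx n D)" for k
      using mem[of "Suc k"] by (simp add: mult_ac)
    then have "(frac (real n * x), frac (real n * y)) \<in> G"
      unfolding G_def using off_grid_scale[OF og] by auto
    moreover have "digit_cell n D \<lfloor>real n * x\<rfloor> \<lfloor>real n * y\<rfloor>"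
      using mem[of 0] mem_H\<^sub>1_iff_digit_cell[OF off_grid_1[OF og]] by simp
    ultimately show "q \<in> digit_map n D G"
      using frac_mem_digit_map[of n] n2 by (simp add: q)
  qed
  have "compact (closure G)"
    using \<open>bounded G\<close> by simp
  moreover have "closure G \<subseteq> digit_map n D (closure G)"
  proof (rule closure_minimal)
    show "G \<subseteq> digit_map n D (closure G)"
      using sub digit_map_mono[OF closure_subset] by blast
    show "closed (digit_map n D (closure G))"
      using \<open>compact (closure G)\<close> by (intro compact_imp_closed compact_digit_map finite_digits)
  qed
  ultimately have "closure G \<subseteq> fractal_square n D"
    using subset_of_digit_map_invariant[OF n2, of "closure G" D "fractal_square n D"] fractal_square
    by (simp add: compact_imp_closed)
  moreover have "(frac x, frac y) \<in> G"
    unfolding G_def using assms by blast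
  ultimately show ?thesis
    using closure_subset by (intro mem_periodic_extension_frac) blast
qed

end

section \<open>Lines and their countably many grid points\<close>

lemma scale_fibre_line:
  "p \<in> fibre_line \<tau> \<omega> \<Longrightarrow> c *\<^sub>R p \<in> fibre_line \<tau> (c * \<omega>)"
  by (auto simp: fibre_line_def algebra_simps)

lemma countable_affine_vimage_Ints:
  fixes a b c :: real
  assumes "a \<noteq> 0" "c \<noteq> 0"
  shows "countable {t. c * (b + a * t) \<in> \<int>}"
proof (rule countable_subset)
  show "{t. c * (b + a * t) \<in> \<int>} \<subseteq> (\<lambda>z. (z / c - b) / a) ` \<int>"
    using assms by (auto simp: image_iff field_simps intro!: bexI[rotated])
  show "countable ((\<lambda>z. (z / c - b) / a) ` \<int>)"
    by (intro countable_image countable_int)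
qed

text \<open>Both coordinates are non-constant affine functions of the parameter \<open>t\<close>, as
  \<tau> is nonzero, so only countably many \<open>t\<close> give points on the grid. The parameters
  of points outside the closed set \<open>C\<close> form an open set, which cannot be non-empty and
  countable.\<close>

lemma fibre_line_subsetI:
  assumes "n \<ge> 1" "\<tau> \<noteq> 0" "closed C"
    and C: "\<And>x y. x - \<tau> * y = \<omega> \<Longrightarrow> off_grid n (x, y) \<Longrightarrow> (x, y) \<in> C"
  shows "fibre_line \<tau> \<omega> \<subseteq> C"
proof -
  let ?f = "\<lambda>t. (\<omega> + \<tau> * t, t)"
  \<comment> \<open>The second coordinate is written \<open>0 + 1 * t\<close> to match
    \<open>countable_affine_vimage_Ints\<close>.\<close>
  have "{t. \<not> off_grid n (?f t)} =
      (\<Union>k. {t. real n ^ k * (\<omega> + \<tau> * t) \<in> \<int>} \<union> {t. real n ^ k * (0 + 1 * t) \<in> \<int>})"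
    by (auto simp: off_grid_def)
  moreover have "countable \<dots>"
    by (intro countable_UN countable_Un countable_affine_vimage_Ints) (use assms in auto)
  ultimately have "countable {t. \<not> off_grid n (?f t)}" by simp
  moreover have "open (?f -` (- C))"
    by (intro open_vimage continuous_intros) (use assms in auto)
  ultimately have "?f -` (- C) = {}"
    using open_minus_countable[of "{t. \<not> off_grid n (?f t)}" "?f -` (- C)"] C by fastforce
  then have "?f t \<in> C" for t
    by blast
  then show ?thesis
    by (auto simp: fibre_line_def algebra_simps)
qed

section \<open>Projections of open unit squares along the lines\<close>

lemma open_square_fibre_iff:
  fixes i j \<tau> v :: real
  shows "(\<exists>x y. i < x \<and> x < i + 1 \<and> j < y \<and> y < j + 1 \<and> x - \<tau> * y = v) \<longleftrightarrow>
    i - max (\<tau> * j) (\<tau> * (j + 1)) < v \<and> v < i + 1 - min (\<tau> * j) (\<tau> * (j + 1))"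
    (is "?L \<longleftrightarrow> ?lo < v \<and> v < ?hi")
proof
  assume ?L
  then obtain x y where *: "i < x" "x < i + 1" "j < y" "y < j + 1" "x - \<tau> * y = v"
    by blast
  show "?lo < v \<and> v < ?hi"
  proof (cases "\<tau> \<ge> 0")
    case True
    then have "\<tau> * j \<le> \<tau> * y" "\<tau> * y \<le> \<tau> * (j + 1)"
      using * by (auto intro!: mult_left_mono)
    with * show ?thesis by linarith
  next
    case False
    then have "\<tau> * j \<ge> \<tau> * y" "\<tau> * y \<ge> \<tau> * (j + 1)"
      using * by (auto intro!: mult_left_mono_neg)
    with * show ?thesis by linarith
  qed
next
  assume v: "?lo < v \<and> v < ?hi"
  \<comment> \<open>\<open>t\<close> is the relative position of \<open>v\<close> in the interval.
    The witness is the point at parameter \<open>t\<close> on the diagonal of the square that joins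
    the corners projecting to the two end points; the sign of \<tau> decides which diagonal this
    is.\<close>
  define t where "t = (v - ?lo) / (?hi - ?lo)"
  have t: "0 < t" "t < 1" "v = ?lo + t * (?hi - ?lo)"
    using v by (auto simp: t_def field_simps)
  show ?L
  proof (cases "\<tau> \<ge> 0")
    case True
    then have "\<tau> * j \<le> \<tau> * (j + 1)" by (intro mult_left_mono) auto
    then have "(i + t) - \<tau> * (j + 1 - t) = v"
      using t(3) by (simp add: algebra_simps)
    with t(1,2) show ?thesis by (intro exI[of _ "i + t"] exI[of _ "j + 1 - t"]) auto
  next
    case False
    then have "\<tau> * j \<ge> \<tau> * (j + 1)" by (intro mult_left_mono_neg) auto
    then have "(i + t) - \<tau> * (j + t) = v"
      using t(3) by (simp add: algebra_simps)
    with t(1,2) show ?thesis by (intro exI[of _ "i + t"] exI[of _ "j + t"]) auto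
  qed
qed

text \<open>The corners are integral and the slope has denominator \<open>s\<close>, so multiplying
  by \<open>s\<close> makes the end points integers. Later only their integrality matters, not their
  values.\<close>

lemma integer_endpoints_of_open_square_fibres:
  fixes r s i j :: int
  assumes "s \<ge> 1"
  obtains a b :: int where
    "\<And>v. (\<exists>x y. of_int i < x \<and> x < of_int i + 1 \<and> of_int j < y \<and> y < of_int j + 1 \<and>
        x - of_int r / of_int s * y = v) \<longleftrightarrow> of_int a < of_int s * v \<and> of_int s * v < real_of_int b"
proof
  fix v :: real
  have s: "real_of_int s > 0" using assms by simp
  have "real_of_int r / of_int s * of_int j = of_int (r * j) / of_int s"
    "real_of_int r / of_int s * (of_int j + 1) = of_int (r * (j + 1)) / of_int s"
    by simp_all
  then have *:
    "max (of_int r / of_int s * of_int j) (of_int r / of_int s * (of_int j + 1)) =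
      real_of_int (max (r * j) (r * (j + 1))) / of_int s"
    "min (of_int r / of_int s * of_int j) (of_int r / of_int s * (of_int j + 1)) =
      real_of_int (min (r * j) (r * (j + 1))) / of_int s"
    using s by (simp_all only: of_int_max of_int_min max_divide_distrib_right min_divide_distrib_right less_imp_le if_True)
  show "(\<exists>x y. of_int i < x \<and> x < of_int i + 1 \<and> of_int j < y \<and> y < of_int j + 1 \<and>
        x - of_int r / of_int s * y = v) \<longleftrightarrow>
      of_int (s * i - max (r * j) (r * (j + 1))) < of_int s * v \<and>
      of_int s * v < real_of_int (s * (i + 1) - min (r * j) (r * (j + 1)))"
    unfolding open_square_fibre_iff * of_int_diff of_int_mult of_int_add of_int_1
    using s by (simp add: field_simps)
qed

lemma funpow_times_map_frac: "(times_map n ^^ k) (frac x) = frac (real n ^ k * x)"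
proof (induction k)
  case (Suc k)
  have "frac (real n * frac z) = frac (real n * z)" for z
  proof -
    have "real n * z = real n * frac z + of_int (int n * \<lfloor>z\<rfloor>)"
      by (simp add: frac_def algebra_simps)
    then show ?thesis by (metis frac_add_of_int_right)
  qed
  with Suc show ?case by (simp add: times_map_def mult.assoc)
qed simp

section \<open>Structure of \<open>Omega1\<close> and the lines contained in H\<close>

context
  fixes n :: nat and D :: "(nat \<times> nat) set" and r s :: int and \<tau> :: real
  assumes n2: "n \<ge> 2" and D_sub: "D \<subseteq> {..<n} \<times> {..<n}" and D_ne: "D \<noteq> {}"
    and coprime_rs: "coprime r s" and s_pos: "s \<ge> 1" and r_ne: "r \<noteq> 0"
    and \<tau>_eq: "\<tau> = real_of_int r / real_of_int s"
begin

lemma \<tau>_ne: "\<tau> \<noteq> 0"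
  using s_pos r_ne \<tau>_eq by simp

text \<open>Forwards, dilation by \<open>n\<close> preserves H and moves the line over \<omega> to
  the line over \<open>real n * \<omega>\<close>, while H lies in H_1. Backwards, H is closed, so it
  suffices to treat the points off the grid, where \<open>off_grid_mem_H\<close> applies.\<close>

lemma fibre_line_subset_H_iff:
  "fibre_line \<tau> \<omega> \<subseteq> periodic_extension (fractal_square n D) \<longleftrightarrow>
    (\<forall>k. real n ^ k * \<omega> \<in> Omega1 n D \<tau>)"
proof
  assume L: "fibre_line \<tau> \<omega> \<subseteq> periodic_extension (fractal_square n D)"
  have sub: "fibre_line \<tau> (real n ^ k * \<omega>) \<subseteq> periodic_extension (fractal_square n D)" for k
  proof (induction k)
    case (Suc k)
    show ?case
    proof
      fix p assume "p \<in> fibre_line \<tau> (real n ^ Suc k * \<omega>)"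
      then have "(1 / real n) *\<^sub>R p \<in> fibre_line \<tau> (real n ^ k * \<omega>)"
        using scale_fibre_line[of p \<tau> _ "1 / real n"] n2 by fastforce
      then have "real n *\<^sub>R (1 / real n) *\<^sub>R p \<in> periodic_extension (fractal_square n D)"
        using Suc scale_H[OF n2 D_sub D_ne] by blast
      then show "p \<in> periodic_extension (fractal_square n D)"
        using n2 by simp
    qed
  qed (use L in simp)
  then show "\<forall>k. real n ^ k * \<omega> \<in> Omega1 n D \<tau>"
    using periodic_extension_mono[OF F_subset_first_approx[OF n2 D_sub D_ne]]
    unfolding Omega1_def by blast
next
  assume *: "\<forall>k. real n ^ k * \<omega> \<in> Omega1 n D \<tau>"
  show "fibre_line \<tau> \<omega> \<subseteq> periodic_extension (fractal_square n D)"
  proof (rule fibre_line_subsetI)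
    fix x y assume xy: "x - \<tau> * y = \<omega>" "off_grid n (x, y)"
    have "(real n ^ k * x, real n ^ k * y) \<in> periodic_extension (first_approx n D)" for k
    proof -
      have "real n ^ k * x - \<tau> * (real n ^ k * y) = real n ^ k * \<omega>"
        using xy(1) by (simp add: algebra_simps)
      then show ?thesis
        using * unfolding Omega1_def fibre_line_def by blast
    qed
    with xy(2) show "(x, y) \<in> periodic_extension (fractal_square n D)"
      by (rule off_grid_mem_H[OF n2 D_sub D_ne])
  qed (use n2 \<tau>_ne closed_H[OF n2 D_sub D_ne] in auto)
qed

text \<open>Dilation by \<open>n\<close> turns the cells of H_1 into unit cells with integer
  corners. Open cells are enough: H_1 is closed, so the grid points of the line take care of
  themselves.\<close>

lemma mem_Omega1_iff:
  "\<omega> \<in> Omega1 n D \<tau> \<longleftrightarrow>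
    (\<forall>i j x y. of_int i < x \<and> x < of_int i + 1 \<and> of_int j < y \<and> y < of_int j + 1 \<and>
      x - \<tau> * y = real n * \<omega> \<longrightarrow> digit_cell n D i j)"
proof (intro iffI allI impI)
  fix i j x y
  assume \<omega>: "\<omega> \<in> Omega1 n D \<tau>"
    and "of_int i < x \<and> x < of_int i + 1 \<and> of_int j < y \<and> y < of_int j + 1 \<and>
      x - \<tau> * y = real n * \<omega>"
  then have xy: "of_int i < x" "x < of_int i + 1" "of_int j < y" "y < of_int j + 1"
    "x - \<tau> * y = real n * \<omega>" by auto
  have floor: "\<lfloor>x\<rfloor> = i" "\<lfloor>y\<rfloor> = j" and notin: "x \<notin> \<int>" "y \<notin> \<int>"
    using xy by (auto elim!: Ints_cases simp: floor_eq_iff)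
  have "x / real n - \<tau> * (y / real n) = \<omega>"
    using xy(5) n2 by (simp add: field_simps)
  with \<omega> have "(x / real n, y / real n) \<in> periodic_extension (first_approx n D)"
    unfolding Omega1_def fibre_line_def by blast
  then show "digit_cell n D i j"
    using mem_H\<^sub>1_iff_digit_cell[OF n2 D_sub D_ne, of "x / real n" "y / real n"] n2 notin floor
    by simp
next
  assume *: "\<forall>i j x y. of_int i < x \<and> x < of_int i + 1 \<and> of_int j < y \<and> y < of_int j + 1 \<and>
      x - \<tau> * y = real n * \<omega> \<longrightarrow> digit_cell n D i j"
  have floor: "of_int \<lfloor>z\<rfloor> < z \<and> z < of_int \<lfloor>z\<rfloor> + 1" if "z \<notin> \<int>" for z :: real
    using that by (metis Ints_of_int floor_correct less_eq_real_def of_int_1 of_int_add)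
  have "fibre_line \<tau> \<omega> \<subseteq> periodic_extension (first_approx n D)"
  proof (rule fibre_line_subsetI)
    fix x y assume xy: "x - \<tau> * y = \<omega>" "off_grid n (x, y)"
    note notin = off_grid_1[OF xy(2)]
    have "real n * x - \<tau> * (real n * y) = real n * \<omega>"
      using xy(1) by (simp add: algebra_simps)
    then have "digit_cell n D \<lfloor>real n * x\<rfloor> \<lfloor>real n * y\<rfloor>"
      using * floor[OF notin(1)] floor[OF notin(2)] by blast
    then show "(x, y) \<in> periodic_extension (first_approx n D)"
      using mem_H\<^sub>1_iff_digit_cell[OF n2 D_sub D_ne notin] by blast
  qed (use n2 \<tau>_ne closed_H\<^sub>1[OF n2 D_sub D_ne] in auto)
  then show "\<omega> \<in> Omega1 n D \<tau>"
    by (simp add: Omega1_def)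
qed

text \<open>Every open cell met by the line over \<open>real n * \<omega>'\<close> is also met by
  the line over \<open>real n * \<omega>\<close>: scaled by \<open>s\<close>, its projection is an
  open interval with integer end points, and once it meets [\<open>m\<close>, \<open>m + 1\<close>]
  it contains the open interval between \<open>m\<close> and \<open>m + 1\<close>.\<close>

lemma Omega1_fill_interval:
  assumes \<omega>: "\<omega> \<in> Omega1 n D \<tau>"
    and m: "of_int m < real n * s * \<omega>" "real n * s * \<omega> < of_int m + 1"
    and m': "of_int m \<le> real n * s * \<omega>'" "real n * s * \<omega>' \<le> of_int m + 1"
  shows "\<omega>' \<in> Omega1 n D \<tau>"
  unfolding mem_Omega1_iff
proof (intro allI impI)
  fix i j x y
  assume xy: "of_int i < x \<and> x < of_int i + 1 \<and> of_int j < y \<and> y < of_int j + 1 \<and>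
      x - \<tau> * y = real n * \<omega>'"
  obtain a b :: int where ab:
    "\<And>v. (\<exists>x y. of_int i < x \<and> x < of_int i + 1 \<and> of_int j < y \<and> y < of_int j + 1 \<and>
        x - of_int r / of_int s * y = v) \<longleftrightarrow> of_int a < of_int s * v \<and> of_int s * v < real_of_int b"
    using integer_endpoints_of_open_square_fibres[OF s_pos] by blast
  have "of_int a < of_int s * (real n * \<omega>')" "of_int s * (real n * \<omega>') < real_of_int b"
    using ab xy \<tau>_eq by blast+
  then have "a \<le> m" "m + 1 \<le> b"
    using m' by (simp_all add: mult_ac)
  then have "of_int a < of_int s * (real n * \<omega>) \<and> of_int s * (real n * \<omega>) < real_of_int b"
    using m by (auto simp: mult_ac)
  then show "digit_cell n D i j"
    using \<omega> ab \<tau>_eq unfolding mem_Omega1_iff by blast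
qed

text \<open>H_1 is invariant under integer translations. Translating by (\<open>a\<close>,
  \<open>b\<close>) adds \<open>a - \<tau> * b\<close> to \<omega>, and by Bezout
  \<open>s * a - r * b\<close> takes every integer value.\<close>

lemma Omega1_shift:
  assumes \<omega>: "\<omega> \<in> Omega1 n D \<tau>"
  shows "\<omega> + of_int k / of_int s \<in> Omega1 n D \<tau>"
proof -
  obtain u v where uv: "u * r + v * s = 1"
    using bezout_int[of r s] coprime_rs by auto
  define a b where "a = k * v" and "b = - (k * u)"
  have "s * a - r * b = k"
    using arg_cong[OF uv, of "\<lambda>z. k * z"] by (simp add: a_def b_def algebra_simps)
  then have "of_int s * of_int a - of_int r * of_int b = real_of_int k"
    by (metis of_int_diff of_int_mult)
  then have ab: "of_int a - \<tau> * of_int b = of_int k / of_int s"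
    using s_pos by (simp add: \<tau>_eq field_simps)
  have "(x, y) \<in> periodic_extension (first_approx n D)"
    if "x - \<tau> * y = \<omega> + of_int k / of_int s" for x y
  proof -
    have "(x - of_int a) - \<tau> * (y - of_int b) = \<omega>"
      using that ab by (simp add: algebra_simps)
    then have "(x - of_int a, y - of_int b) \<in> periodic_extension (first_approx n D)"
      using \<omega> unfolding Omega1_def fibre_line_def by blast
    from periodic_extension_shift[OF this, of a b] show ?thesis by simp
  qed
  then show ?thesis
    by (auto simp: Omega1_def fibre_line_def)
qed

lemma frac_mem_Omega1_tilde: "frac \<omega> \<in> Omega1_tilde n D \<tau> \<longleftrightarrow> \<omega> \<in> Omega1 n D \<tau>"
proof -
  have "\<omega> + of_int (- \<lfloor>\<omega>\<rfloor> * s) / of_int s = frac \<omega>" "frac \<omega> + of_int (\<lfloor>\<omega>\<rfloor> * s) / of_int s = \<omega>"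
    using s_pos by (simp_all add: frac_def)
  then have "frac \<omega> \<in> Omega1 n D \<tau> \<longleftrightarrow> \<omega> \<in> Omega1 n D \<tau>"
    using Omega1_shift by metis
  then show ?thesis
    by (simp add: Omega1_tilde_def frac_lt_1)
qed

lemma interval_in_Omega1_tilde:
  assumes \<omega>: "\<omega> \<in> Omega1 n D \<tau>" and notin: "real n * s * \<omega> \<notin> \<int>"
  shows "\<exists>a b. a < b \<and> {a<..<b} \<subseteq> Omega1_tilde n D \<tau>"
proof -
  define N where "N = int n * s"
  have N: "N > 0" "real_of_int N = real n * s"
    using n2 s_pos by (auto simp: N_def)
  define m where "m = \<lfloor>real_of_int N * frac \<omega>\<rfloor>"
  have mem: "frac \<omega> \<in> Omega1 n D \<tau>"
    using \<omega> frac_mem_Omega1_tilde[of \<omega>] by (simp add: Omega1_tilde_def)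
  have "real_of_int N * \<omega> = real_of_int N * frac \<omega> + of_int (N * \<lfloor>\<omega>\<rfloor>)"
    by (simp add: frac_def algebra_simps)
  then have "real_of_int N * frac \<omega> \<notin> \<int>"
    using notin N(2) by (metis Ints_add Ints_of_int)
  then have m: "of_int m < real_of_int N * frac \<omega>" "real_of_int N * frac \<omega> < of_int m + 1"
    unfolding m_def by (metis Ints_of_int floor_correct less_eq_real_def) linarith
  \<comment> \<open>The interval around \<open>frac \<omega>\<close> stays within [0, 1), because 0
    and 1 are themselves multiples of 1 / \<open>N\<close>.\<close>
  have "0 \<le> m"
    using N(1) by (simp add: m_def)
  have "real_of_int N * frac \<omega> < of_int N"
    using N(1) frac_lt_1[of \<omega>] by simp
  then have "m + 1 \<le> N"
    using m(1) by linarith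
  have "{of_int m / of_int N<..<(of_int m + 1) / real_of_int N} \<subseteq> Omega1_tilde n D \<tau>"
  proof
    fix x assume "x \<in> {of_int m / of_int N<..<(of_int m + 1) / real_of_int N}"
    then have x: "of_int m < real_of_int N * x" "real_of_int N * x < of_int m + 1"
      using N(1) by (auto simp: field_simps)
    have "x \<in> Omega1 n D \<tau>"
      using Omega1_fill_interval[OF mem, of m x] m x N(2) by simp
    moreover have "0 < real_of_int N * x" "real_of_int N * x < real_of_int N * 1"
      using x \<open>0 \<le> m\<close> \<open>m + 1 \<le> N\<close> by linarith+
    then have "0 \<le> x" "x < 1"
      using N(1) by (simp_all add: zero_less_mult_iff)
    ultimately show "x \<in> Omega1_tilde n D \<tau>"
      by (simp add: Omega1_tilde_def)
  qed
  moreover have "of_int m / of_int N < (of_int m + 1) / real_of_int N"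
    using N(1) by (simp add: divide_strict_right_mono)
  ultimately show ?thesis by blast
qed

text \<open>It suffices to find a point of \<open>Omega1\<close> that multiplication by
  \<open>n\<close> moves by a multiple of 1 / \<open>s\<close>, since such shifts preserve
  \<open>Omega1\<close>.\<close>

lemma fixed_point_in_Omega1:
  assumes "a < b" "{a<..<b} \<subseteq> Omega1 n D \<tau>"
  shows "\<exists>\<omega>. \<forall>k. real n ^ k * \<omega> \<in> Omega1 n D \<tau>"
proof -
  have s: "real_of_int s > 0" and n: "real n > 1"
    using s_pos n2 by auto
  have "countable {t. (real n * s) * (0 + 1 * t) \<in> \<int>}"
    by (rule countable_affine_vimage_Ints) (use s n in auto)
  then obtain \<omega> where \<omega>: "\<omega> \<in> {a<..<b}" "real n * s * \<omega> \<notin> \<int>"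
    using open_minus_countable[of _ "{a<..<b}"] assms(1) by force
  define m where "m = \<lfloor>real n * s * \<omega>\<rfloor>"
  have m: "of_int m < real n * s * \<omega>" "real n * s * \<omega> < of_int m + 1"
    unfolding m_def using \<omega>(2) by (metis Ints_of_int floor_correct less_eq_real_def) linarith
  define c q where "c = m mod int n" and "q = m div int n"
  have c: "0 \<le> c" "c \<le> int n - 1" "m = c + int n * q"
    using n2 by (auto simp: c_def q_def)
  \<comment> \<open>Up to the factor 1 / \<open>s\<close> this is the number 0.ccc... in base
    \<open>n\<close>, so multiplication by \<open>n\<close> adds \<open>c\<close> /
    \<open>s\<close>. Moreover \<open>real n * s * \<omega>'\<close> equals
    \<open>c + c / (n - 1)\<close>, which lies in [\<open>c\<close>, \<open>c + 1\<close>]; both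
    ends occur, for \<open>c = 0\<close> and \<open>c = n - 1\<close>. The shift by \<open>q\<close>
    / \<open>s\<close> then moves it into [\<open>m\<close>, \<open>m + 1\<close>].\<close>
  define \<omega>' where "\<omega>' = of_int c / ((real n - 1) * s)"
  have "real n * s * (\<omega>' + of_int q / of_int s) = real n * of_int c / (real n - 1) + real n * of_int q"
    using s n by (simp add: \<omega>'_def field_simps)
  moreover have "of_int c \<le> real n * of_int c / (real n - 1)"
    using c(1) n by (simp add: field_simps)
  moreover have "real_of_int c \<le> real n - 1"
    using c(2) by linarith
  then have "real n * of_int c / (real n - 1) \<le> of_int c + 1"
    using n by (simp add: field_simps)
  ultimately have "\<omega>' + of_int q / of_int s \<in> Omega1 n D \<tau>"
    using Omega1_fill_interval[OF _ m, of "\<omega>' + of_int q / of_int s"] assms(2) \<omega>(1) c(3) by auto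
  then have "\<omega>' \<in> Omega1 n D \<tau>"
    using Omega1_shift[of "\<omega>' + of_int q / of_int s" "- q"] by simp
  have fixed: "real n * \<omega>' = \<omega>' + of_int c / of_int s"
    using s n by (simp add: \<omega>'_def field_simps)
  have "real n ^ k * \<omega>' \<in> Omega1 n D \<tau>" for k
  proof (induction k)
    case (Suc k)
    have "real n ^ Suc k * \<omega>' = real n ^ k * \<omega>' + of_int (int n ^ k * c) / of_int s"
      unfolding power_Suc2 mult.assoc fixed by (simp add: distrib_left)
    with Omega1_shift[OF Suc] show ?case by metis
  qed (use \<open>\<omega>' \<in> Omega1 n D \<tau>\<close> in simp)
  then show ?thesis by blast
qed

end

theorem theorem3p3:
  fixes n :: nat and D :: "(nat \<times> nat) set" and r s :: int and \<tau> :: real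
  assumes "n \<ge> 2"
    and "D \<subseteq> {0..n - 1} \<times> {0..n - 1}"
    and "1 < card D" and "card D < n ^ 2"
    and "coprime r s" and "s \<ge> 1" and "r \<noteq> 0"
    and "\<tau> = real_of_int r / real_of_int s"
  shows "(\<exists>\<omega>. fibre_line \<tau> \<omega> \<subseteq> periodic_extension (fractal_square n D)) \<longleftrightarrow>
    (\<exists>a b. a < b \<and> {a<..<b} \<subseteq> Omega1_tilde n D \<tau>) \<or>
    (\<exists>\<alpha>\<in>{0..<1}. (\<exists>m::int. \<alpha> = real_of_int m / (real n * real_of_int s)) \<and>
      {(times_map n ^^ k) \<alpha> |k. True} \<subseteq> Omega1_tilde n D \<tau>)"
    (is "?H \<longleftrightarrow> ?I \<or> ?O")
proof -
  have D: "D \<subseteq> {..<n} \<times> {..<n}" "D \<noteq> {}"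
    using assms(1-3) by auto
  note ctx = assms(1) D assms(5-8)
  have H_iff: "?H \<longleftrightarrow> (\<exists>\<omega>. \<forall>k. real n ^ k * \<omega> \<in> Omega1 n D \<tau>)"
    using fibre_line_subset_H_iff[OF ctx] by simp
  show ?thesis
  proof
    assume ?H
    then obtain \<omega> where \<omega>: "\<And>k. real n ^ k * \<omega> \<in> Omega1 n D \<tau>"
      using H_iff by blast
    show "?I \<or> ?O"
    \<comment> \<open>Off the multiples of 1 / (\<open>n\<close> \<open>s\<close>), membership of
      \<omega> itself already yields an interval. Otherwise \<open>frac \<omega>\<close> is the
      required \<alpha>, and its orbit consists of the fractional parts of
      \<open>real n ^ k * \<omega>\<close>.\<close>
    proof (cases "real n * s * \<omega> \<in> \<int>")
      case False
      then show ?thesis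
        using interval_in_Omega1_tilde[OF ctx, of \<omega>] \<omega>[of 0] by simp
    next
      case True
      then obtain m where m: "real n * s * \<omega> = of_int m"
        by (auto elim: Ints_cases)
      have "frac \<omega> = of_int (m - int n * s * \<lfloor>\<omega>\<rfloor>) / (real n * of_int s)"
        using m assms(1,6) by (simp add: frac_def field_simps)
      moreover have "{(times_map n ^^ k) (frac \<omega>) |k. True} \<subseteq> Omega1_tilde n D \<tau>"
        using \<omega> frac_mem_Omega1_tilde[OF ctx] by (auto simp: funpow_times_map_frac)
      moreover have "frac \<omega> \<in> {0..<1}"
        by (simp add: frac_lt_1)
      ultimately show ?thesis by blast
    qed
  next
    assume "?I \<or> ?O"
    then show ?H
    proof
      assume ?I
      then show ?H
        using fixed_point_in_Omega1[OF ctx] H_iff by (metis Omega1_tilde_def le_inf_iff)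
    next
      assume ?O
      then obtain \<alpha> where \<alpha>: "\<alpha> \<in> {0..<1}" "\<And>k. (times_map n ^^ k) \<alpha> \<in> Omega1_tilde n D \<tau>"
        by blast
      then have "frac \<alpha> = \<alpha>"
        by (simp add: frac_eq)
      then have "real n ^ k * \<alpha> \<in> Omega1 n D \<tau>" for k
        using \<alpha>(2)[of k] funpow_times_map_frac[of k n \<alpha>] frac_mem_Omega1_tilde[OF ctx] by simp
      then show ?H
        using H_iff by blast
    qed
  qed
qed

end
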